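(* Let $O:E\to B$ and $A:E\to[0,\infty]$ be functions between sets (with $[0,\infty]$ the extended nonnegative reals), and define $Q_A:B\to[0,\infty]$ by $$Q_A(b):=\inf\{A(e):e\in E,\ O(e)=b\},\qquad\inf\varnothing=\infty.$$ Then $Q_A\circ O\le A$ pointwise. If $H:B\to[0,\infty]$ satisfies $H\circ O\le A$ pointwise, then $H\le Q_A$ pointwise. Hence $Q_A$ is the greatest function of behavior alone (i.e. the greatest function $H:B\to[0,\infty]$) satisfying $H(O(e))\le A(e)$ for every $e\in E$. *)

theory Defs
  imports "HOL-Library.Extended_Nonnegative_Real" "HOL-Library.FuncSet"
begin

text \<open>
  The sets E and B are carrier sets, so that they may be empty. Functions from B to
  \<open>[0,\<infinity>]\<close> are the extensional functions \<open>B \<rightarrow>\<^sub>E UNIV\<close>; on these, the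
  order \<open>\<le>\<close> of the function type is the pointwise order on B, because any two of them
  agree outside B.
\<close>

definition quotient_cost ::
  "'e set \<Rightarrow> 'b set \<Rightarrow> ('e \<Rightarrow> 'b) \<Rightarrow> ('e \<Rightarrow> ennreal) \<Rightarrow> 'b \<Rightarrow> ennreal" where
  "quotient_cost E B Obs A = (\<lambda>b\<in>B. Inf {A e | e. e \<in> E \<and> Obs e = b})"

lemma quotient_cost_empty_fibre:
  assumes "b \<in> B" "b \<notin> Obs ` E"
  shows "quotient_cost E B Obs A b = \<infinity>"
proof -
  have "{A e | e. e \<in> E \<and> Obs e = b} = {}"
    using assms(2) by auto
  then show ?thesis
    unfolding quotient_cost_def by (simp only: restrict_apply assms(1) if_True Inf_empty infinity_ennreal_def)
qed

definition behavioral_minorants ::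
  "'e set \<Rightarrow> 'b set \<Rightarrow> ('e \<Rightarrow> 'b) \<Rightarrow> ('e \<Rightarrow> ennreal) \<Rightarrow> ('b \<Rightarrow> ennreal) set" where
  "behavioral_minorants E B Obs A = {H \<in> B \<rightarrow>\<^sub>E UNIV. \<forall>e\<in>E. H (Obs e) \<le> A e}"

definition is_greatest :: "'a::order set \<Rightarrow> 'a \<Rightarrow> bool" where
  "is_greatest S x \<longleftrightarrow> x \<in> S \<and> (\<forall>y\<in>S. y \<le> x)"

end

theory Submission
  imports Defs
begin

text \<open>
  The condition \<open>H (Obs e) \<le> A e\<close> for all \<open>e\<close> splits over the fibres of \<open>Obs\<close>: it says that, for
  each \<open>b\<close> in the image, the value \<open>H b\<close> is a lower bound of the values of \<open>A\<close> on the fibre over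
  \<open>b\<close>. The infimum over the fibre is the greatest such bound, and the convention
  \<open>inf \<emptyset> = \<infinity>\<close> makes this true over the points outside the image as well. So the quotient
  cost is itself a minorant and dominates every other one on \<open>B\<close>; off \<open>B\<close> all extensional functions
  agree, so that it is a greatest element in the function order, where antisymmetry makes it unique.
\<close>

lemma quotient_cost_le:
  assumes "Obs \<in> E \<rightarrow> B" "e \<in> E"
  shows "quotient_cost E B Obs A (Obs e) \<le> A e"
proof -
  have "Obs e \<in> B"
    using assms by auto
  then show ?thesis
    using assms(2) by (auto simp: quotient_cost_def intro!: Inf_lower)
qed

lemma le_quotient_cost:
  assumes "\<And>e. e \<in> E \<Longrightarrow> H (Obs e) \<le> A e" "b \<in> B"
  shows "H b \<le> quotient_cost E B Obs A b"
  using assms by (auto simp: quotient_cost_def intro!: Inf_greatest)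

lemma is_greatest_unique:
  assumes "is_greatest S x" "is_greatest S y"
  shows "x = y"
  using assms by (auto simp: is_greatest_def intro: antisym)

lemma is_greatest_quotient_cost:
  assumes "Obs \<in> E \<rightarrow> B"
  shows "is_greatest (behavioral_minorants E B Obs A) (quotient_cost E B Obs A)"
  unfolding is_greatest_def
proof (intro conjI ballI)
  have "quotient_cost E B Obs A \<in> B \<rightarrow>\<^sub>E UNIV"
    by (simp add: quotient_cost_def)
  then show "quotient_cost E B Obs A \<in> behavioral_minorants E B Obs A"
    using quotient_cost_le[OF assms] by (simp add: behavioral_minorants_def)
next
  fix H assume H: "H \<in> behavioral_minorants E B Obs A"
  show "H \<le> quotient_cost E B Obs A"
  proof (rule le_funI)
    fix b
    show "H b \<le> quotient_cost E B Obs A b"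
    proof (cases "b \<in> B")
      case True
      then show ?thesis
        using H by (intro le_quotient_cost) (auto simp: behavioral_minorants_def)
    next
      case False
      then have "H b = undefined"
        using H by (auto simp: behavioral_minorants_def PiE_def extensional_def)
      then show ?thesis
        using False by (simp add: quotient_cost_def)
    qed
  qed
qed

theorem theorem28p2:
  fixes E :: "'e set" and B :: "'b set"
    and Obs :: "'e \<Rightarrow> 'b" and A :: "'e \<Rightarrow> ennreal"
  assumes "Obs \<in> E \<rightarrow> B"
  shows "(\<forall>e\<in>E. quotient_cost E B Obs A (Obs e) \<le> A e) \<and>
    (\<forall>H :: 'b \<Rightarrow> ennreal. (\<forall>e\<in>E. H (Obs e) \<le> A e) \<longrightarrow>
       (\<forall>b\<in>B. H b \<le> quotient_cost E B Obs A b)) \<and>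
    (\<forall>G. is_greatest (behavioral_minorants E B Obs A) G \<longleftrightarrow> G = quotient_cost E B Obs A)"
proof (intro conjI allI ballI impI)
  show "quotient_cost E B Obs A (Obs e) \<le> A e" if "e \<in> E" for e
    using assms that by (rule quotient_cost_le)
  show "H b \<le> quotient_cost E B Obs A b"
    if "\<forall>e\<in>E. H (Obs e) \<le> A e" "b \<in> B" for H :: "'b \<Rightarrow> ennreal" and b
    using that by (intro le_quotient_cost) auto
  show "is_greatest (behavioral_minorants E B Obs A) G \<longleftrightarrow> G = quotient_cost E B Obs A" for G
    using is_greatest_quotient_cost[OF assms] is_greatest_unique by metis
qed

end
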